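(* Let $P_X,P_Y$ be probability distributions on $\mathbb{R}^d$ such that, for $X\sim P_X$ and $Y\sim P_Y$, the random variables $\beta^\top X$ and $\beta^\top Y$ have continuous distribution functions for $\lambda$-almost all $\beta\in\mathbb{S}^{d-1}$. Suppose $X_1,X_2$ are i.i.d. from $P_X$ and, independently, $Y_1,Y_2$ are i.i.d. from $P_Y$. Then $$W_d^2(P_X,P_Y)=\frac13-\frac1{2\pi}\mathbb{E}\big[\mathsf{Ang}(X_1-Y_1,X_2-Y_1)\big]-\frac1{2\pi}\mathbb{E}\big[\mathsf{Ang}(Y_1-X_1,Y_2-X_1)\big].$$
   Context: $\mathbb{S}^{d-1}$ is the unit sphere of $\mathbb{R}^d$ and $\lambda$ the uniform probability measure on it. For nonzero $U_1,U_2\in\mathbb{R}^d$, $\mathsf{Ang}(U_1,U_2)=\arccos\{U_1^\top U_2/(\|U_1\|\|U_2\|)\}$. The squared multivariate CvM-distance is $$W_d^2(P_X,P_Y)=\int_{\mathbb{S}^{d-1}}\int_{\mathbb{R}}\big(F_{\beta^\top X}(t)-F_{\beta^\top Y}(t)\big)^2\,dH_\beta(t)\,d\lambda(\beta),\qquad H_\beta=\vartheta_XF_{\beta^\top X}+\vartheta_YF_{\beta^\top Y},$$ where $F_{\beta^\top X},F_{\beta^\top Y}$ are the distribution functions of $\beta^\top X,\beta^\top Y$, $\vartheta_X\in(0,1)$ is fixed and $\vartheta_Y=1-\vartheta_X$. *)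

theory Defs
  imports "HOL-Probability.Probability"
begin

(* The cone measure: the law of U / norm U for U uniformly distributed on the unit ball,
   regarded as a measure on the sphere. Note sgn x = x /\<^sub>R norm x; the value sgn 0 = 0, which
   is not on the sphere, only concerns a null set. *)
definition uniform_sphere :: "'a::euclidean_space measure" where
  "uniform_sphere =
     restrict_space (distr (uniform_measure lborel (cball 0 1)) borel sgn) (sphere 0 1)"

lemma space_uniform_sphere: "space uniform_sphere = sphere 0 1"
  by (simp add: uniform_sphere_def space_restrict_space)

lemma prob_space_uniform_sphere: "prob_space (uniform_sphere :: 'a::euclidean_space measure)"
proof -
  let ?U = "uniform_measure lborel (cball 0 1 :: 'a set)"
  have pos: "emeasure lborel (cball 0 1 :: 'a set) \<noteq> 0"
    using unit_ball_vol_pos[of "real DIM('a)"] by (simp add: emeasure_cball less_imp_neq[THEN not_sym])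
  have fin: "emeasure lborel (cball 0 1 :: 'a set) \<noteq> \<infinity>"
    by (simp add: emeasure_cball)
  interpret U: prob_space ?U
    by (rule prob_space_uniform_measure[OF pos fin])
  have sgn_borel: "sgn \<in> borel_measurable (borel :: 'a measure)"
    unfolding sgn_div_norm by measurable
  have sgn_U: "sgn \<in> measurable ?U borel"
    using sgn_borel by simp
  interpret D: prob_space "distr ?U borel sgn"
    by (rule U.prob_space_distr[OF sgn_U])
  have "AE x in lborel. x \<noteq> (0::'a)"
    by (rule AE_lborel_singleton)
  hence "AE x in ?U. x \<noteq> 0"
    by (intro AE_uniform_measureI) auto
  hence "AE x in ?U. sgn x \<in> sphere 0 1"
    by eventually_elim (simp add: norm_sgn)
  hence "AE x in distr ?U borel sgn. x \<in> sphere 0 1"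
    using sgn_U by (subst AE_distr_iff) (auto simp: sphere_def)
  hence "emeasure (distr ?U borel sgn) (sphere 0 1) = 1"
    by (intro D.emeasure_eq_1_AE) auto
  thus ?thesis
    unfolding uniform_sphere_def
    by (intro prob_space_restrict_space) auto
qed

(* Intended for nonzero arguments; the library's x / 0 = 0 gives pi / 2 if one of them is 0. *)
definition Ang :: "'a::euclidean_space \<Rightarrow> 'a \<Rightarrow> real" where
  "Ang u v = arccos ((u \<bullet> v) / (norm u * norm v))"

definition proj_cdf :: "'a::euclidean_space measure \<Rightarrow> 'a \<Rightarrow> real \<Rightarrow> real" where
  "proj_cdf P \<beta> = cdf (distr P borel (\<lambda>x. \<beta> \<bullet> x))"

(* The inner integral is the Lebesgue-Stieltjes integral with respect to dH_beta. *)
definition cvm_distance_sq ::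
    "real \<Rightarrow> 'a::euclidean_space measure \<Rightarrow> 'a measure \<Rightarrow> real" where
  "cvm_distance_sq \<theta> P Q =
     (\<integral>\<beta>. (\<integral>t. (proj_cdf P \<beta> t - proj_cdf Q \<beta> t)\<^sup>2
              \<partial>interval_measure (\<lambda>t. \<theta> * proj_cdf P \<beta> t + (1 - \<theta>) * proj_cdf Q \<beta> t))
       \<partial>uniform_sphere)"

end

theory Submission
  imports Defs
begin

text \<open>
  For a direction \<open>\<beta>\<close> in which the projections have continuous distribution functions \<open>F\<close>, \<open>G\<close>, the
  identities \<open>\<integral>F\<^sup>2 dF = 1/3\<close> and \<open>2 \<integral>FG dF + \<integral>F\<^sup>2 dG = 1\<close> give
  \<open>\<integral>(F - G)\<^sup>2 dF = \<integral>(F - G)\<^sup>2 dG = \<integral>F\<^sup>2 dG + \<integral>G\<^sup>2 dF - 2/3\<close>, which is why the weight \<open>\<theta>\<close>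
  drops out. Now \<open>\<integral>F\<^sup>2 dG\<close> is the probability that \<open>\<beta>\<close> has nonpositive inner product with both
  \<open>X\<^sub>1 - Y\<^sub>1\<close> and \<open>X\<^sub>2 - Y\<^sub>1\<close>. By Fubini it remains to compute the measure of the directions \<open>\<beta>\<close> with
  \<open>u \<bullet> \<beta> \<le> 0\<close> and \<open>v \<bullet> \<beta> \<le> 0\<close>, which is \<open>1/2 - Ang u v / (2 \<pi>)\<close>: by rotation invariance the measure
  of \<open>{u \<bullet> \<beta> \<le> 0 < v \<bullet> \<beta>}\<close> is an additive nonnegative function of the angle, hence linear.
\<close>

subsection \<open>Orthogonal invariance of Lebesgue measure\<close>

lemma nn_integral_lborel_plus:
  fixes f :: "'a::euclidean_space \<Rightarrow> ennreal"
  assumes [measurable]: "f \<in> borel_measurable borel"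
  shows "(\<integral>\<^sup>+y. f (x + y) \<partial>lborel) = (\<integral>\<^sup>+y. f y \<partial>lborel)"
proof -
  have "(\<integral>\<^sup>+y. f y \<partial>distr lborel borel ((+) x)) = (\<integral>\<^sup>+y. f (x + y) \<partial>lborel)"
    by (subst nn_integral_distr) auto
  thus ?thesis by (simp add: lborel_distr_plus)
qed

lemma nn_integral_lborel_diff:
  fixes f :: "'a::euclidean_space \<Rightarrow> ennreal"
  assumes [measurable]: "f \<in> borel_measurable borel"
  shows "(\<integral>\<^sup>+y. f (x - y) \<partial>lborel) = (\<integral>\<^sup>+y. f y \<partial>lborel)"
proof -
  have "(\<integral>\<^sup>+y. f y \<partial>lborel) = (\<integral>\<^sup>+y. f y \<partial>distr lborel borel (\<lambda>y. x + (- 1) *\<^sub>R y))"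
    by (subst lborel_affine[of "- 1" x]) (simp_all add: density_1)
  also have "\<dots> = (\<integral>\<^sup>+y. f (x - y) \<partial>lborel)"
    by (subst nn_integral_distr) auto
  finally show ?thesis ..
qed

lemma borel_measurable_orthogonal_transformation:
  fixes T :: "'a::euclidean_space \<Rightarrow> 'a"
  assumes "orthogonal_transformation T"
  shows "T \<in> borel_measurable borel"
  using orthogonal_transformation_linear[OF assms]
  by (intro borel_measurable_continuous_onI linear_continuous_on) (simp add: linear_conv_bounded_linear)

text \<open>
  The library's \<open>measure_orthogonal_image\<close> needs a wellordered index type. Here both measures are
  translation invariant, so evaluating the measure of \<open>A \<times> B\<close> in the two orders of integration
  shows that they are proportional, and they agree on the unit ball.
\<close>
lemma distr_orthogonal_transformation_lborel:
  fixes T :: "'a::euclidean_space \<Rightarrow> 'a"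
  assumes T: "orthogonal_transformation T"
  shows "distr lborel borel T = lborel"
proof (rule measure_eqI)
  have lin: "linear T" and nT: "\<And>x. norm (T x) = norm x"
    using T by (auto simp: orthogonal_transformation_linear orthogonal_transformation_norm)
  note [measurable] = borel_measurable_orthogonal_transformation[OF T]
  define N where "N = distr lborel borel T"
  have [measurable_cong, simp]: "sets N = sets borel" by (simp add: N_def)
  \<comment> \<open>Balls centred at 0 are their own preimages under \<open>T\<close>, so they
    exhaust the space with finite \<open>N\<close>-measure.\<close>
  interpret N: sigma_finite_measure N
  proof
    show "\<exists>A. countable A \<and> A \<subseteq> sets N \<and> \<Union> A = space N \<and> (\<forall>a\<in>A. emeasure N a \<noteq> \<infinity>)"
    proof (intro exI[of _ "range (\<lambda>n::nat. cball 0 (real n))"] conjI ballI)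
      show "\<Union> (range (\<lambda>n. cball 0 (real n))) = space N"
        by (auto simp: N_def real_arch_simple)
      fix a assume "a \<in> range (\<lambda>n. cball (0::'a) (real n))"
      then obtain n where a: "a = cball 0 (real n)" by auto
      have "T -` a = a" by (auto simp: a nT)
      thus "emeasure N a \<noteq> \<infinity>"
        unfolding N_def by (subst emeasure_distr) (auto simp: a emeasure_cball)
    qed auto
  qed
  interpret pair_sigma_finite N "lborel :: 'a measure" ..
  \<comment> \<open>A shift by \<open>c = T d\<close> after \<open>T\<close> is a shift by
    \<open>d\<close> before \<open>T\<close>, which Lebesgue measure absorbs.\<close>
  have tr: "(\<integral>\<^sup>+x. f (x + c) \<partial>N) = (\<integral>\<^sup>+x. f x \<partial>N)"
    if [measurable]: "f \<in> borel_measurable borel" for f :: "'a \<Rightarrow> ennreal" and c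
  proof -
    obtain d where d: "c = T d"
      using orthogonal_transformation_surj[OF T] by (metis surjD)
    have "(\<integral>\<^sup>+x. f (x + c) \<partial>N) = (\<integral>\<^sup>+x. f (T (d + x)) \<partial>lborel)"
      unfolding N_def by (subst nn_integral_distr) (auto simp: d linear_add[OF lin] add.commute)
    also have "\<dots> = (\<integral>\<^sup>+x. f (T x) \<partial>distr lborel borel ((+) d))"
      by (subst nn_integral_distr) auto
    also have "\<dots> = (\<integral>\<^sup>+x. f x \<partial>N)"
      unfolding N_def by (subst lborel_distr_plus, subst nn_integral_distr) auto
    finally show ?thesis .
  qed
  define B :: "'a set" where "B = cball 0 1"
  have [measurable]: "B \<in> sets borel" by (simp add: B_def)
  fix A assume "A \<in> sets (distr lborel borel T)"
  hence [measurable]: "A \<in> sets borel" by simp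
  have "emeasure N A * emeasure lborel B = (\<integral>\<^sup>+x. (\<integral>\<^sup>+y. indicator A x * indicator B y \<partial>lborel) \<partial>N)"
    by (subst nn_integral_cmult_indicator, simp, subst nn_integral_multc) simp_all
  \<comment> \<open>In the inner integrals \<open>y\<close> becomes \<open>x + y\<close>, then
    \<open>x\<close> becomes \<open>x - y\<close>, then \<open>x - y\<close> becomes
    \<open>y\<close>: the shift moves from \<open>B\<close> to \<open>A\<close> and
    disappears.\<close>
  also have "\<dots> = (\<integral>\<^sup>+x. (\<integral>\<^sup>+y. indicator A x * indicator B (x + y) \<partial>lborel) \<partial>N)"
    by (rule nn_integral_cong, rule nn_integral_lborel_plus[symmetric]) measurable
  also have "\<dots> = (\<integral>\<^sup>+y. (\<integral>\<^sup>+x. indicator A x * indicator B (x + y) \<partial>N) \<partial>lborel)"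
    by (rule Fubini'[symmetric]) measurable
  also have "\<dots> = (\<integral>\<^sup>+y. (\<integral>\<^sup>+x. indicator A (x - y) * indicator B x \<partial>N) \<partial>lborel)"
  proof (rule nn_integral_cong)
    fix y :: 'a
    show "(\<integral>\<^sup>+x. indicator A x * indicator B (x + y) \<partial>N) = (\<integral>\<^sup>+x. indicator A (x - y) * indicator B x \<partial>N)"
      using tr[of "\<lambda>x. indicator A (x - y) * indicator B x" y] by simp
  qed
  also have "\<dots> = (\<integral>\<^sup>+x. (\<integral>\<^sup>+y. indicator A (x - y) * indicator B x \<partial>lborel) \<partial>N)"
    by (rule Fubini') measurable
  also have "\<dots> = (\<integral>\<^sup>+x. (\<integral>\<^sup>+y. indicator A y * indicator B x \<partial>lborel) \<partial>N)"
    by (rule nn_integral_cong, rule nn_integral_lborel_diff) measurable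
  also have "\<dots> = emeasure lborel A * emeasure N B"
    by (subst nn_integral_multc, simp, subst nn_integral_cmult) simp_all
  also have "emeasure N B = emeasure lborel B"
  proof -
    have "T -` B = B" by (auto simp: B_def nT)
    thus ?thesis unfolding N_def by (subst emeasure_distr) auto
  qed
  finally have *: "emeasure N A * emeasure lborel B = emeasure lborel A * emeasure lborel B" .
  have "emeasure lborel B \<noteq> 0" "emeasure lborel B \<noteq> \<infinity>"
    using unit_ball_vol_pos[of "real DIM('a)"] by (simp_all add: B_def emeasure_cball less_imp_neq[THEN not_sym])
  with * show "emeasure (distr lborel borel T) A = emeasure lborel A"
    by (simp add: N_def mult.commute[of _ "emeasure lborel B"] ennreal_mult_cancel_left)
qed simp

section \<open>The uniform distribution on the unit ball\<close>

text \<open>Its image under \<open>sgn\<close>, restricted to the sphere, is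
  \<open>uniform_sphere\<close>. Events given by signs of inner products are unchanged by positive
  scaling, so they can be measured on the ball.\<close>

definition ball_measure :: "'a::euclidean_space measure" where
  "ball_measure = uniform_measure lborel (cball 0 1)"

lemma sets_ball_measure [measurable_cong, simp]: "sets ball_measure = sets borel"
  and space_ball_measure [simp]: "space ball_measure = UNIV"
  by (simp_all add: ball_measure_def)

lemma prob_space_ball_measure: "prob_space (ball_measure :: 'a::euclidean_space measure)"
  unfolding ball_measure_def
  using unit_ball_vol_pos[of "real DIM('a)"]
  by (intro prob_space_uniform_measure) (simp_all add: emeasure_cball less_imp_neq[THEN not_sym])

interpretation ball_measure: prob_space "ball_measure :: 'a::euclidean_space measure"
  by (rule prob_space_ball_measure)

lemma distr_orthogonal_transformation_ball_measure:
  fixes T :: "'a::euclidean_space \<Rightarrow> 'a"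
  assumes T: "orthogonal_transformation T"
  shows "distr ball_measure borel T = ball_measure"
proof (rule measure_eqI)
  have nT: "\<And>x. norm (T x) = norm x"
    using T by (rule orthogonal_transformation_norm)
  note [measurable] = borel_measurable_orthogonal_transformation[OF T]
  fix A :: "'a set" assume "A \<in> sets (distr ball_measure borel T)"
  hence [measurable]: "A \<in> sets borel" by simp
  have v: "T -` A \<in> sets borel" using measurable_sets_borel[of T borel A] by simp
  have "emeasure lborel (cball 0 1 \<inter> T -` A) = emeasure (distr lborel borel T) (cball 0 1 \<inter> A)"
    by (subst emeasure_distr) (auto simp: nT intro!: arg_cong2[where f=emeasure])
  also have "\<dots> = emeasure lborel (cball 0 1 \<inter> A)"
    by (simp add: distr_orthogonal_transformation_lborel T)
  finally show "emeasure (distr ball_measure borel T) A = emeasure ball_measure A"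
    using v by (simp add: emeasure_distr ball_measure_def emeasure_uniform_measure)
qed simp

lemma measure_ball_orthogonal_vimage:
  fixes T :: "'a::euclidean_space \<Rightarrow> 'a"
  assumes T: "orthogonal_transformation T" and [measurable]: "A \<in> sets borel"
  shows "measure ball_measure (T -` A) = measure ball_measure A"
proof -
  note [measurable] = borel_measurable_orthogonal_transformation[OF T]
  show ?thesis
    by (subst (2) distr_orthogonal_transformation_ball_measure[OF T, symmetric])
       (simp add: measure_distr)
qed

lemma AE_ball_measureI:
  assumes "AE x in lborel. P x"
  shows "AE x in ball_measure. P x"
  unfolding ball_measure_def
  using assms by (intro AE_uniform_measureI) (auto elim: eventually_mono)

text \<open>A hyperplane through the origin is Lebesgue null. This lets strict and weak inequalities
  be exchanged below.\<close>

lemma AE_ball_measure_inner_neq_0: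
  fixes w :: "'a::euclidean_space"
  assumes "w \<noteq> 0"
  shows "AE x in ball_measure. w \<bullet> x \<noteq> 0"
proof (rule AE_ball_measureI)
  have "negligible {x. w \<bullet> x = 0}" using assms by (intro negligible_hyperplane) auto
  hence "{x. w \<bullet> x = 0} \<in> null_sets lebesgue" by (rule negligible_iff_null_sets[THEN iffD1])
  hence "{x. w \<bullet> x = 0} \<in> null_sets lborel"
    by (subst (asm) null_sets_completion_iff) auto
  thus "AE x in lborel. w \<bullet> x \<noteq> 0" by (intro AE_I') auto
qed

text \<open>The map \<open>x\<close> to \<open>- x\<close> exchanges the two closed half-spaces;
  they cover the space and overlap in a null set.\<close>

lemma measure_ball_halfspace:
  fixes w :: "'a::euclidean_space"
  assumes "w \<noteq> 0"
  shows "measure ball_measure {x. w \<bullet> x \<le> 0} = 1 / 2"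
proof -
  have "orthogonal_transformation (uminus :: 'a \<Rightarrow> 'a)"
    by (simp add: orthogonal_transformation_neg orthogonal_transformation_id)
  hence "measure ball_measure (uminus -` {x. w \<bullet> x \<le> 0}) = measure ball_measure {x. w \<bullet> x \<le> 0}"
    by (rule measure_ball_orthogonal_vimage) measurable
  hence 1: "measure ball_measure {x. 0 \<le> w \<bullet> x} = measure ball_measure {x. w \<bullet> x \<le> 0}"
    by (simp add: vimage_def)
  have "measure ball_measure {x. 0 \<le> w \<bullet> x} = measure ball_measure {x. 0 < w \<bullet> x}"
    using AE_ball_measure_inner_neq_0[OF assms]
    by (intro ball_measure.finite_measure_eq_AE) (auto elim!: eventually_mono)
  also have "{x. 0 < w \<bullet> x} = UNIV - {x. w \<bullet> x \<le> 0}" by auto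
  also have "measure ball_measure (UNIV - {x. w \<bullet> x \<le> 0}) = 1 - measure ball_measure {x. w \<bullet> x \<le> 0}"
    by (subst ball_measure.prob_compl[simplified]) auto
  finally show ?thesis using 1 by simp
qed

section \<open>Nonnegative additive functions on an interval; bounds for the angle\<close>

text \<open>Nonnegativity makes \<open>D\<close> monotone, and additivity makes it linear on
  multiples of \<open>c / n\<close>. Squeezing \<open>a\<close> between neighbouring multiples
  leaves an error of at most \<open>D c / n\<close>.\<close>

lemma additive_nonneg_imp_linear:
  fixes D :: "real \<Rightarrow> real"
  assumes add: "\<And>a b. 0 \<le> a \<Longrightarrow> 0 \<le> b \<Longrightarrow> a + b \<le> c \<Longrightarrow> D (a + b) = D a + D b"
    and nonneg: "\<And>a. 0 \<le> a \<Longrightarrow> a \<le> c \<Longrightarrow> 0 \<le> D a"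
    and a: "0 \<le> a" "a \<le> c" and c: "0 < c"
  shows "D a = a / c * D c"
proof -
  have mono: "D x \<le> D y" if "0 \<le> x" "x \<le> y" "y \<le> c" for x y
    using add[of x "y - x"] nonneg[of "y - x"] that by simp
  have mult: "D (real k * h) = real k * D h" if "0 \<le> h" "real k * h \<le> c" for k h
    using that
  proof (induction k)
    case 0
    show ?case using add[of 0 0] c by simp
  next
    case (Suc k)
    hence "real k * h \<le> c" by (simp add: algebra_simps)
    with Suc add[of "real k * h" h] show ?case by (simp add: algebra_simps)
  qed
  have bound: "\<bar>D a - a / c * D c\<bar> \<le> D c / real n" if n: "0 < n" for n :: nat
  proof (cases "a = c")
    case True
    thus ?thesis using c nonneg[of c] by simp
  next
    case False
    define h where "h = c / real n"
    have h: "0 < h" using c n by (simp add: h_def)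
    have Dc: "D h = D c / real n"
      using mult[of h n] h n c by (simp add: h_def field_simps)
    \<comment> \<open>The grid cell with \<open>k * h \<le> a < Suc k * h\<close>. Since
      \<open>a < c\<close> here, \<open>Suc k \<le> n\<close> and the upper grid point does not
      exceed \<open>c\<close>; for \<open>a = c\<close> it would, hence the case split.\<close>
    define k where "k = nat \<lfloor>a / h\<rfloor>"
    have k: "real k = of_int \<lfloor>a / h\<rfloor>" using a h by (simp add: k_def)
    have k1: "real k * h \<le> a"
      using of_int_floor_le[of "a / h"] unfolding k pos_le_divide_eq[OF h] .
    have k2: "a < real (Suc k) * h"
      using floor_correct[of "a / h"] h by (simp add: k pos_divide_less_eq[OF h, symmetric] add.commute)
    have "real k < real n"
    proof -
      have "real k * h < real n * h" using k1 False a n by (simp add: h_def)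
      thus ?thesis using h by simp
    qed
    hence "real (Suc k) \<le> real n" by simp
    hence "real (Suc k) * h \<le> real n * h" using h by (intro mult_right_mono) auto
    hence k3: "real (Suc k) * h \<le> c" using n by (simp add: h_def)
    have "real k * D h \<le> D a"
      using mult[of h k] mono[of "real k * h" a] k1 h a by simp
    moreover have "D a \<le> real (Suc k) * D h"
      using mult[of h "Suc k"] mono[of a "real (Suc k) * h"] k2 k3 h a by simp
    moreover have "D h \<ge> 0" using k3 h nonneg[of h] by (simp add: algebra_simps) (smt (verit) mult_nonneg_nonneg of_nat_0_le_iff)
    moreover have "a / c * D c = a / h * D h" using n c unfolding Dc by (simp add: h_def)
    moreover have "real k * D h \<le> a / h * D h" "a / h * D h \<le> real (Suc k) * D h"
      using k1 k2 h by (intro mult_right_mono[OF _ \<open>D h \<ge> 0\<close>]; simp add: pos_le_divide_eq pos_divide_le_eq)+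
    ultimately have "\<bar>D a - a / c * D c\<bar> \<le> D h" by (simp add: algebra_simps)
    thus ?thesis by (simp add: Dc)
  qed
  have "(\<lambda>n. D c / real n) \<longlonglongrightarrow> 0"
    by (rule lim_const_over_n)
  hence "\<bar>D a - a / c * D c\<bar> \<le> 0"
    by (rule Lim_bounded2[where N = 1]) (use bound in auto)
  thus ?thesis by simp
qed

lemma abs_inner_div_norms_le_1:
  fixes u v :: "'a::real_inner"
  shows "\<bar>(u \<bullet> v) / (norm u * norm v)\<bar> \<le> 1"
proof (cases "u = 0 \<or> v = 0")
  case False
  hence "0 < norm u * norm v" by simp
  thus ?thesis using Cauchy_Schwarz_ineq2[of u v] by (simp add: abs_mult pos_divide_le_eq)
qed auto

text \<open>\<open>arccos\<close> is continuous on [-1, 1]. Clamping its argument gives a continuous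
  function on the whole line and, by Cauchy-Schwarz, changes no value of \<open>Ang\<close>.\<close>

lemma borel_measurable_Ang [measurable (raw)]:
  fixes f g :: "'b \<Rightarrow> 'a::euclidean_space"
  assumes [measurable]: "f \<in> borel_measurable M" "g \<in> borel_measurable M"
  shows "(\<lambda>x. Ang (f x) (g x)) \<in> borel_measurable M"
proof -
  have "(\<lambda>t::real. arccos (max (- 1) (min 1 t))) \<in> borel_measurable borel"
    by (intro borel_measurable_continuous_onI continuous_on_arccos continuous_intros) auto
  moreover have "Ang u v = arccos (max (- 1) (min 1 ((u \<bullet> v) / (norm u * norm v))))" for u v :: 'a
  proof -
    have "max (- 1) (min 1 t) = t" if "\<bar>t\<bar> \<le> 1" for t :: real using that by auto
    thus ?thesis by (simp only: Ang_def abs_inner_div_norms_le_1)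
  qed
  ultimately show ?thesis
    using measurable_compose[of "\<lambda>x. (f x \<bullet> g x) / (norm (f x) * norm (g x))" M borel] by simp
qed

lemma Ang_bounds: "0 \<le> Ang u v \<and> Ang u v \<le> pi"
  using abs_inner_div_norms_le_1[of u v]
  unfolding Ang_def abs_le_iff by (intro conjI arccos_lbound arccos_ubound) linarith+

subsection \<open>The measure of a lune\<close>

text \<open>One inequality is weak and the other strict so that the sets for \<open>p, q\<close> and
  for \<open>q, r\<close> are disjoint and their measures add.\<close>

definition wedge :: "'a::euclidean_space \<Rightarrow> 'a \<Rightarrow> real" where
  "wedge p q = measure ball_measure {x. p \<bullet> x \<le> 0 \<and> 0 < q \<bullet> x}"

lemma wedge_orthogonal_transformation:
  fixes T :: "'a::euclidean_space \<Rightarrow> 'a"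
  assumes T: "orthogonal_transformation T"
  shows "wedge (T p) (T q) = wedge p q"
proof -
  have "measure ball_measure (T -` {x. T p \<bullet> x \<le> 0 \<and> 0 < T q \<bullet> x}) = wedge (T p) (T q)"
    unfolding wedge_def by (rule measure_ball_orthogonal_vimage[OF T]) measurable
  thus ?thesis
    using T by (simp add: wedge_def vimage_def orthogonal_transformation_def)
qed

text \<open>For orthonormal \<open>e\<close> and \<open>f\<close>, the point at angle
  \<open>a\<close> on the unit circle of their plane, measured from \<open>e\<close> towards
  \<open>f\<close>.\<close>

definition circ :: "'a::euclidean_space \<Rightarrow> 'a \<Rightarrow> real \<Rightarrow> 'a" where
  "circ e f a = cos a *\<^sub>R e + sin a *\<^sub>R f"

text \<open>\<open>T\<close> rotates the plane of \<open>e\<close> and \<open>f\<close> by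
  \<open>a\<close> and fixes its orthogonal complement; \<open>p x\<close> and \<open>q x\<close>
  are the coordinates of \<open>T x - x\<close> in that plane.\<close>

lemma circ_rotation:
  fixes e f :: "'a::euclidean_space"
  assumes ef: "e \<bullet> e = 1" "f \<bullet> f = 1" "e \<bullet> f = 0"
  obtains T where "orthogonal_transformation T" "\<And>b. T (circ e f b) = circ e f (a + b)"
proof
  define p where "p x = (cos a - 1) * (e \<bullet> x) - sin a * (f \<bullet> x)" for x
  define q where "q x = sin a * (e \<bullet> x) + (cos a - 1) * (f \<bullet> x)" for x
  define T where "T x = x + p x *\<^sub>R e + q x *\<^sub>R f" for x
  have fe: "f \<bullet> e = 0" using ef by (simp add: inner_commute)
  have lin: "p (x + y) = p x + p y" "p (c *\<^sub>R x) = c * p x"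
    "q (x + y) = q x + q y" "q (c *\<^sub>R x) = c * q x" for x y c
    by (simp_all add: p_def q_def inner_add_right algebra_simps)
  show "orthogonal_transformation T"
    unfolding orthogonal_transformation_def
  proof (intro conjI allI)
    show "linear T"
      by (rule linearI) (simp_all add: T_def lin scaleR_add_left scaleR_add_right)
    fix v w
    have "T v \<bullet> T w = v \<bullet> w + p w * (e \<bullet> v) + q w * (f \<bullet> v) + p v * (e \<bullet> w) + q v * (f \<bullet> w)
        + p v * p w + q v * q w"
      by (simp add: T_def inner_add_left inner_add_right ef fe inner_commute[of v e] inner_commute[of v f] distrib_left)
    also have "\<dots> = v \<bullet> w"
      using sin_cos_squared_add3[of a] unfolding p_def q_def by algebra
    finally show "T v \<bullet> T w = v \<bullet> w" .
  qed
  fix b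
  have "e \<bullet> circ e f b = cos b" "f \<bullet> circ e f b = sin b"
    using ef fe by (auto simp: circ_def inner_add_right)
  thus "T (circ e f b) = circ e f (a + b)"
    unfolding T_def p_def q_def by (simp add: circ_def cos_add sin_add algebra_simps)
qed

text \<open>The measure is additive in the angle, since a rotation moves the wedge between angles 0
  and \<open>b\<close> to the one between \<open>a\<close> and \<open>a + b\<close>. At
  \<open>pi\<close> the wedge is a half-space up to a null set, of measure 1/2; nonnegativity then
  forces linearity.\<close>

lemma wedge_circ:
  fixes e f :: "'a::euclidean_space"
  assumes ef: "e \<bullet> e = 1" "f \<bullet> f = 1" "e \<bullet> f = 0" and a: "0 \<le> a" "a \<le> pi"
  shows "wedge e (circ e f a) = a / (2 * pi)"
proof -
  let ?W = "circ e f"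
  define D where "D a = wedge e (?W a)" for a
  have fe: "f \<bullet> e = 0" using ef by (simp add: inner_commute)
  have W0 [simp]: "?W 0 = e" by (simp add: circ_def)
  have WW: "?W b \<bullet> ?W b = 1" for b
    using ef fe by (simp add: circ_def inner_simps power2_eq_square[symmetric])
  have Wn: "?W b \<noteq> 0" for b using WW[of b] by auto
  have shift: "wedge (?W a) (?W (a + b)) = D b" for a b
  proof -
    obtain T where "orthogonal_transformation T" "\<And>b. T (?W b) = ?W (a + b)"
      using circ_rotation[OF ef] by metis
    with wedge_orthogonal_transformation[of T "?W 0" "?W b"] show ?thesis
      by (simp add: D_def del: W0) simp
  qed
  have D0: "D 0 = 0" by (auto simp: D_def wedge_def not_le intro!: arg_cong[where f="measure _", of _ "{}", simplified])
  have "D (a + b) = D a + D b" if ab: "0 \<le> a" "0 \<le> b" "a + b \<le> pi" for a b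
  proof (cases "a = 0 \<or> b = 0")
    case True
    thus ?thesis using D0 by auto
  next
    case False
    hence s: "0 < sin a" "0 < sin b" using ab by (auto intro!: sin_gt_zero)
    have s': "0 \<le> sin (a + b)" using ab by (intro sin_ge_zero) auto
    have "AE x in ball_measure. e \<bullet> x \<noteq> 0 \<and> ?W a \<bullet> x \<noteq> 0 \<and> ?W (a + b) \<bullet> x \<noteq> 0"
      using AE_ball_measure_inner_neq_0[OF Wn[of 0]] AE_ball_measure_inner_neq_0[OF Wn[of a]]
        AE_ball_measure_inner_neq_0[OF Wn[of "a + b"]] by eventually_elim simp
    hence "AE x in ball_measure. (x \<in> {x. e \<bullet> x \<le> 0 \<and> 0 < ?W (a + b) \<bullet> x}) =
       (x \<in> {x. e \<bullet> x \<le> 0 \<and> 0 < ?W a \<bullet> x} \<union> {x. ?W a \<bullet> x \<le> 0 \<and> 0 < ?W (a + b) \<bullet> x})"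
    proof eventually_elim
      fix x assume x: "e \<bullet> x \<noteq> 0 \<and> ?W a \<bullet> x \<noteq> 0 \<and> ?W (a + b) \<bullet> x \<noteq> 0"
      \<comment> \<open>A nonnegative multiple of the middle vector is a positive combination of the
        outer two, so its inner product with \<open>x\<close> cannot have the sign opposite to both
        outer ones. The two patterns excluded are those on which the sets would differ.\<close>
      have eq: "sin (a + b) * (?W a \<bullet> x) = sin b * (e \<bullet> x) + sin a * (?W (a + b) \<bullet> x)"
        using sin_cos_squared_add3[of a]
        unfolding circ_def inner_add_left inner_scaleR_left sin_add cos_add by algebra
      have "\<not> (e \<bullet> x < 0 \<and> 0 < ?W a \<bullet> x \<and> ?W (a + b) \<bullet> x < 0)"
      proof
        assume *: "e \<bullet> x < 0 \<and> 0 < ?W a \<bullet> x \<and> ?W (a + b) \<bullet> x < 0"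
        have "sin b * (e \<bullet> x) < 0" "sin a * (?W (a + b) \<bullet> x) < 0" "sin (a + b) * (?W a \<bullet> x) \<ge> 0"
          using * s s' by (auto simp: mult_pos_neg)
        thus False using eq by linarith
      qed
      moreover have "\<not> (0 < e \<bullet> x \<and> ?W a \<bullet> x < 0 \<and> 0 < ?W (a + b) \<bullet> x)"
      proof
        assume *: "0 < e \<bullet> x \<and> ?W a \<bullet> x < 0 \<and> 0 < ?W (a + b) \<bullet> x"
        have "sin b * (e \<bullet> x) > 0" "sin a * (?W (a + b) \<bullet> x) > 0" "sin (a + b) * (?W a \<bullet> x) \<le> 0"
          using * s s' by (auto simp: mult_nonneg_nonpos)
        thus False using eq by linarith
      qed
      ultimately show "(x \<in> {x. e \<bullet> x \<le> 0 \<and> 0 < ?W (a + b) \<bullet> x}) =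
       (x \<in> {x. e \<bullet> x \<le> 0 \<and> 0 < ?W a \<bullet> x} \<union> {x. ?W a \<bullet> x \<le> 0 \<and> 0 < ?W (a + b) \<bullet> x})"
        using x by auto
    qed
    hence "D (a + b) = measure ball_measure
      ({x. e \<bullet> x \<le> 0 \<and> 0 < ?W a \<bullet> x} \<union> {x. ?W a \<bullet> x \<le> 0 \<and> 0 < ?W (a + b) \<bullet> x})"
      unfolding D_def wedge_def by (intro ball_measure.finite_measure_eq_AE) auto
    also have "\<dots> = D a + wedge (?W a) (?W (a + b))"
      unfolding D_def wedge_def by (intro ball_measure.finite_measure_Union) auto
    finally show ?thesis by (simp add: shift)
  qed
  hence "D a = a / pi * D pi"
    using a by (intro additive_nonneg_imp_linear) (auto simp: D_def wedge_def)
  moreover have "D pi = 1 / 2"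
  proof -
    have "?W pi = - e" by (simp add: circ_def)
    hence "D pi = measure ball_measure {x. e \<bullet> x \<le> 0}"
      unfolding D_def wedge_def using AE_ball_measure_inner_neq_0[OF Wn[of 0]]
      by (intro ball_measure.finite_measure_eq_AE) (auto elim!: eventually_mono)
    thus ?thesis using measure_ball_halfspace[OF Wn[of 0]] by simp
  qed
  ultimately show ?thesis unfolding D_def by simp
qed

text \<open>The half-space \<open>u \<bullet> x \<le> 0\<close> has measure 1/2, and the sign of
  \<open>v \<bullet> x\<close> splits it into the lune and a wedge of angle
  \<open>Ang u v\<close>.\<close>

lemma measure_ball_lune:
  fixes u v :: "'a::euclidean_space"
  assumes u: "u \<noteq> 0" and v: "v \<noteq> 0"
  shows "measure ball_measure {x. u \<bullet> x \<le> 0 \<and> v \<bullet> x \<le> 0} = 1 / 2 - Ang u v / (2 * pi)"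
proof -
  define e g a where "e = sgn u" and "g = sgn v" and "a = Ang u v"
  have e: "e \<bullet> e = 1" and g: "g \<bullet> g = 1"
    using u v by (simp_all add: e_def g_def dot_square_norm norm_sgn)
  have e0: "e \<noteq> 0" using e by auto
  have eg: "e \<bullet> g = (u \<bullet> v) / (norm u * norm v)"
    by (simp add: e_def g_def sgn_div_norm divide_simps)
  have a: "0 \<le> a" "a \<le> pi" using Ang_bounds[of u v] by (simp_all add: a_def)
  have ca: "cos a = e \<bullet> g"
    unfolding a_def Ang_def eg by (rule cos_arccos_abs[OF abs_inner_div_norms_le_1])
  have set: "{x. u \<bullet> x \<le> 0 \<and> v \<bullet> x \<le> 0} = {x. e \<bullet> x \<le> 0 \<and> g \<bullet> x \<le> 0}"
    using u v by (auto simp: e_def g_def sgn_div_norm mult_le_0_iff inverse_nonpositive_iff_nonpositive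
      divide_le_0_iff)
  have split: "measure ball_measure {x. e \<bullet> x \<le> 0 \<and> g \<bullet> x \<le> 0} = 1 / 2 - wedge e g"
  proof -
    have "measure ball_measure {x. e \<bullet> x \<le> 0}
        = measure ball_measure ({x. e \<bullet> x \<le> 0 \<and> g \<bullet> x \<le> 0} \<union> {x. e \<bullet> x \<le> 0 \<and> 0 < g \<bullet> x})"
      by (rule arg_cong[where f = "measure _"]) auto
    also have "\<dots> = measure ball_measure {x. e \<bullet> x \<le> 0 \<and> g \<bullet> x \<le> 0} + wedge e g"
      unfolding wedge_def by (intro ball_measure.finite_measure_Union) auto
    finally show ?thesis using measure_ball_halfspace[OF e0] by simp
  qed
  have "wedge e g = a / (2 * pi)"
  proof (cases "sin a = 0")
    case False
    \<comment> \<open>Gram-Schmidt: \<open>f\<close> is the unit vector orthogonal to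
      \<open>e\<close> that places \<open>g\<close> at angle \<open>a\<close>.\<close>
    define f where "f = (g - cos a *\<^sub>R e) /\<^sub>R sin a"
    have W: "g = circ e f a" using False by (simp add: circ_def f_def)
    have ef: "e \<bullet> f = 0" by (simp add: f_def inner_simps e ca)
    have "f \<bullet> f = (1 - (cos a)\<^sup>2) / (sin a)\<^sup>2"
      by (simp add: f_def inner_simps e g ca[symmetric] inner_commute[of g e])
         (simp add: field_simps power2_eq_square)
    hence ff: "f \<bullet> f = 1" using False by (simp add: sin_squared_eq[symmetric])
    show ?thesis using wedge_circ[OF e ff ef a] W by simp
  next
    case True
    \<comment> \<open>Parallel vectors leave no second direction for \<open>f\<close>. Here
      \<open>g\<close> is \<open>e\<close> or \<open>- e\<close>, and the wedge is empty or a
      half-space up to a null set.\<close>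
    hence "a = 0 \<or> a = pi" using a sin_gt_zero[of a] by force
    hence c: "a = 0 \<and> e \<bullet> g = 1 \<or> a = pi \<and> e \<bullet> g = -1" using ca by auto
    moreover have "g = e" if "e \<bullet> g = 1"
    proof -
      have "(g - e) \<bullet> (g - e) = 0"
        using that e g by (simp add: inner_diff_left inner_diff_right inner_commute)
      thus ?thesis unfolding inner_eq_zero_iff by simp
    qed
    moreover have "g = - e" if "e \<bullet> g = -1"
    proof -
      have "(g + e) \<bullet> (g + e) = 0"
        using that e g by (simp add: inner_add_left inner_add_right inner_commute)
      thus ?thesis unfolding inner_eq_zero_iff by (simp add: eq_neg_iff_add_eq_0)
    qed
    moreover have "wedge e e = 0"
      by (auto simp: wedge_def intro!: arg_cong[where f="measure _", of _ "{}", simplified])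
    moreover have "wedge e (- e) = 1 / 2"
      using measure_ball_halfspace[OF e0] AE_ball_measure_inner_neq_0[OF e0]
      unfolding wedge_def
      by (subst ball_measure.finite_measure_eq_AE[of _ "{x. e \<bullet> x \<le> 0}"]) (auto elim!: eventually_mono)
    ultimately show ?thesis by auto
  qed
  thus ?thesis by (simp add: set split a_def)
qed

subsection \<open>Distribution functions on the line\<close>

lemma (in pair_prob_space) Fubini_integral_bounded:
  fixes f :: "'a \<Rightarrow> 'b \<Rightarrow> real"
  assumes "case_prod f \<in> borel_measurable (M1 \<Otimes>\<^sub>M M2)" and "\<And>x y. \<bar>f x y\<bar> \<le> B"
  shows "(\<integral>y. (\<integral>x. f x y \<partial>M1) \<partial>M2) = (\<integral>x. (\<integral>y. f x y \<partial>M2) \<partial>M1)"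
  using assms by (intro Fubini_integral integrable_const_bound[where B = B]) auto

lemma (in finite_borel_measure) borel_measurable_cdf [measurable]: "cdf M \<in> borel_measurable borel"
  by (intro borel_measurable_mono monoI cdf_nondecreasing)

lemma (in real_distribution) integrable_bounded:
  fixes f :: "real \<Rightarrow> real"
  assumes "f \<in> borel_measurable borel" "\<And>x. \<bar>f x\<bar> \<le> B"
  shows "integrable M f"
  using assms by (intro integrable_const_bound[where B = B]) auto

lemma (in real_distribution) measure_lessThan_eq_cdf:
  assumes "measure M {x} = 0"
  shows "measure M {..<x} = cdf M x"
proof -
  have "cdf M x = measure M ({..<x} \<union> {x})"
    unfolding cdf_def by (simp only: ivl_disj_un)
  also have "\<dots> = measure M {..<x}"
    using assms by (subst finite_measure_Union) auto
  finally show ?thesis ..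
qed

text \<open>For independent \<open>a\<close> from \<open>\<mu>\<close> and \<open>c\<close> from
  \<open>\<rho>\<close> these are the probabilities of \<open>a \<le> c\<close> and
  \<open>c \<le> a\<close>; ties are null because \<open>\<rho>\<close> has no atoms.\<close>

lemma integral_cdf_add_integral_cdf:
  assumes "real_distribution \<mu>" "real_distribution \<rho>" and atom: "\<And>x. measure \<rho> {x} = 0"
  shows "(\<integral>x. cdf \<mu> x \<partial>\<rho>) + (\<integral>x. cdf \<rho> x \<partial>\<mu>) = 1"
proof -
  interpret \<mu>: real_distribution \<mu> by fact
  interpret \<rho>: real_distribution \<rho> by fact
  interpret pair_prob_space \<mu> \<rho> ..
  have "(\<integral>x. cdf \<mu> x \<partial>\<rho>) = (\<integral>c. (\<integral>a. indicator {..c} a \<partial>\<mu>) \<partial>\<rho>)"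
    by (simp add: cdf_def)
  also have "\<dots> = (\<integral>a. (\<integral>c. indicator {..c} a \<partial>\<rho>) \<partial>\<mu>)"
    by (rule Fubini_integral_bounded[where B = 1]) (auto simp: indicator_def)
  also have "\<dots> = (\<integral>a. 1 - cdf \<rho> a \<partial>\<mu>)"
  proof (rule Bochner_Integration.integral_cong)
    fix a
    have "(\<integral>c. indicator {..c} a \<partial>\<rho>) = (\<integral>c. indicator {a..} c \<partial>\<rho>)"
      by (rule Bochner_Integration.integral_cong) (auto simp: indicator_def)
    also have "\<dots> = measure \<rho> (UNIV - {..<a})"
      by (simp add: Compl_eq_Diff_UNIV[symmetric])
    also have "\<dots> = 1 - cdf \<rho> a"
      using \<rho>.prob_compl[of "{..<a}"] by (simp add: \<rho>.measure_lessThan_eq_cdf atom)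
    finally show "(\<integral>c. indicator {..c} a \<partial>\<rho>) = 1 - cdf \<rho> a" .
  qed simp
  also have "\<dots> = 1 - (\<integral>a. cdf \<rho> a \<partial>\<mu>)"
    using \<mu>.integrable_bounded[of "cdf \<rho>" 1]
    by (simp add: \<rho>.cdf_nonneg \<rho>.cdf_bounded_prob \<mu>.prob_space[simplified])
  finally show ?thesis by simp
qed

text \<open>
  Among independent \<open>a \<sim> \<mu>\<close>, \<open>b \<sim> \<nu>\<close>, \<open>c \<sim> \<rho>\<close> almost surely exactly one is the largest.
\<close>
lemma integral_cdf_mult_cyclic:
  assumes "real_distribution \<mu>" "real_distribution \<nu>" "real_distribution \<rho>"
    and atom: "\<And>x. measure \<mu> {x} = 0" "\<And>x. measure \<rho> {x} = 0"
  shows "(\<integral>x. cdf \<mu> x * cdf \<nu> x \<partial>\<rho>) + (\<integral>x. cdf \<nu> x * cdf \<rho> x \<partial>\<mu>) + (\<integral>x. cdf \<rho> x * cdf \<mu> x \<partial>\<nu>) = 1"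
proof -
  interpret \<mu>: real_distribution \<mu> by fact
  interpret \<nu>: real_distribution \<nu> by fact
  interpret \<rho>: real_distribution \<rho> by fact
  interpret pair_prob_space \<mu> \<nu> ..
  \<comment> \<open>The law of the maximum of \<open>a\<close> and \<open>b\<close> has the product
    as its distribution function, so the claim reduces to the two-variable identity for
    \<open>\<eta>\<close> and \<open>\<rho>\<close>.\<close>
  define \<eta> where "\<eta> = distr (\<mu> \<Otimes>\<^sub>M \<nu>) borel (\<lambda>(a, b). max a b)"
  have \<eta>: "real_distribution \<eta>" unfolding \<eta>_def by (rule P.real_distribution_distr) measurable
  have cdf_\<eta>: "cdf \<eta> x = cdf \<mu> x * cdf \<nu> x" for x
  proof -
    have "cdf \<eta> x = measure (\<mu> \<Otimes>\<^sub>M \<nu>) ((\<lambda>(a, b). max a b) -` {..x} \<inter> space (\<mu> \<Otimes>\<^sub>M \<nu>))"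
      unfolding cdf_def \<eta>_def by (subst measure_distr) auto
    also have "(\<lambda>(a, b). max a b) -` {..x} \<inter> space (\<mu> \<Otimes>\<^sub>M \<nu>) = {..x} \<times> {..x}"
      by (auto simp: space_pair_measure)
    finally show ?thesis by (simp add: cdf_def measure_def \<nu>.emeasure_pair_measure_Times enn2real_mult)
  qed
  have int: "(\<integral>x. cdf \<rho> x \<partial>\<eta>) = (\<integral>x. cdf \<nu> x * cdf \<rho> x \<partial>\<mu>) + (\<integral>x. cdf \<rho> x * cdf \<mu> x \<partial>\<nu>)"
  proof -
    \<comment> \<open>The maximum is \<open>a\<close> if \<open>b \<le> a\<close> and
      \<open>b\<close> if \<open>a < b\<close>. Ties go to \<open>?f\<close>, so \<open>?g\<close>
      yields the measure of an open ray, equal to \<open>cdf \<mu>\<close> as \<open>\<mu>\<close>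
      has no atoms.\<close>
    let ?f = "\<lambda>a b. indicator {..a} b * cdf \<rho> a" and ?g = "\<lambda>a b. indicator {..<b} a * cdf \<rho> b"
    have b: "\<bar>?f a b\<bar> \<le> 1" "\<bar>?g a b\<bar> \<le> 1" for a b
      by (auto simp: indicator_def \<rho>.cdf_nonneg \<rho>.cdf_bounded_prob)
    have m: "case_prod ?f \<in> borel_measurable (\<mu> \<Otimes>\<^sub>M \<nu>)" "case_prod ?g \<in> borel_measurable (\<mu> \<Otimes>\<^sub>M \<nu>)"
      unfolding case_prod_beta indicator_def atMost_iff lessThan_iff by measurable
    have i: "integrable (\<mu> \<Otimes>\<^sub>M \<nu>) (case_prod ?f)" "integrable (\<mu> \<Otimes>\<^sub>M \<nu>) (case_prod ?g)"
      using m b by (auto intro!: P.integrable_const_bound[where B = 1])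
    have "(\<integral>x. cdf \<rho> x \<partial>\<eta>) = (\<integral>p. cdf \<rho> (case p of (a, b) \<Rightarrow> max a b) \<partial>(\<mu> \<Otimes>\<^sub>M \<nu>))"
      unfolding \<eta>_def by (subst integral_distr) auto
    also have "\<dots> = (\<integral>p. case_prod ?f p + case_prod ?g p \<partial>(\<mu> \<Otimes>\<^sub>M \<nu>))"
      by (rule Bochner_Integration.integral_cong) (auto simp: indicator_def max_def)
    also have "\<dots> = (\<integral>p. case_prod ?f p \<partial>(\<mu> \<Otimes>\<^sub>M \<nu>)) + (\<integral>p. case_prod ?g p \<partial>(\<mu> \<Otimes>\<^sub>M \<nu>))"
      using i by (rule Bochner_Integration.integral_add)
    also have "(\<integral>p. case_prod ?f p \<partial>(\<mu> \<Otimes>\<^sub>M \<nu>)) = (\<integral>a. (\<integral>b. ?f a b \<partial>\<nu>) \<partial>\<mu>)"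
      using integral_fst'[OF i(1)] by simp
    also have "\<dots> = (\<integral>x. cdf \<nu> x * cdf \<rho> x \<partial>\<mu>)"
      by (simp add: cdf_def)
    also have "(\<integral>p. case_prod ?g p \<partial>(\<mu> \<Otimes>\<^sub>M \<nu>)) = (\<integral>b. (\<integral>a. ?g a b \<partial>\<mu>) \<partial>\<nu>)"
      using integral_snd[OF i(2)] by simp
    also have "\<dots> = (\<integral>x. cdf \<rho> x * cdf \<mu> x \<partial>\<nu>)"
      by (simp add: \<mu>.measure_lessThan_eq_cdf atom mult.commute)
    finally show ?thesis .
  qed
  from integral_cdf_add_integral_cdf[OF \<eta> assms(3) atom(2)] show ?thesis
    by (simp add: cdf_\<eta> int)
qed

text \<open>
  Valid for arbitrary distribution functions. This makes the integrand of \<open>cvm_distance_sq\<close>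
  measurable in every direction, including those where a projection has atoms.
\<close>
lemma integral_interval_measure_mixture:
  fixes f :: "real \<Rightarrow> real"
  assumes "real_distribution \<mu>" "real_distribution \<nu>" and \<theta>: "0 \<le> \<theta>" "\<theta> \<le> 1"
    and f: "f \<in> borel_measurable borel" "\<And>x. \<bar>f x\<bar> \<le> B"
  shows "(\<integral>t. f t \<partial>interval_measure (\<lambda>t. \<theta> * cdf \<mu> t + (1 - \<theta>) * cdf \<nu> t))
    = \<theta> * (\<integral>t. f t \<partial>\<mu>) + (1 - \<theta>) * (\<integral>t. f t \<partial>\<nu>)"
proof -
  interpret \<mu>: real_distribution \<mu> by fact
  interpret \<nu>: real_distribution \<nu> by fact
  define k where "k b = (if b then \<mu> else \<nu>)" for b
  \<comment> \<open>The mixture as a two-stage experiment: a coin with success probability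
    \<open>\<theta>\<close> selects \<open>\<mu>\<close> or \<open>\<nu>\<close>, so integrals
    against \<open>N\<close> split by conditioning on the coin.\<close>
  define N where "N = measure_pmf (bernoulli_pmf \<theta>) \<bind> k"
  have k: "real_distribution (k b)" for b using assms by (simp add: k_def)
  have sk: "sets (k b) = sets borel" for b using k by (simp add: real_distribution.events_eq_borel)
  have pk: "prob_space (k b)" for b using k[of b] by (simp add: real_distribution_def)
  have kK: "k \<in> measurable (measure_pmf (bernoulli_pmf \<theta>)) (subprob_algebra borel)"
    using pk sk by (simp add: space_subprob_algebra prob_space_imp_subprob_space)
  have "prob_space N"
    unfolding N_def by (rule measure_pmf.prob_space_bind[OF _ kK]) (simp add: pk)
  moreover have sN: "sets N = sets borel"
    unfolding N_def by (rule sets_bind) (simp_all add: sk)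
  ultimately have N: "real_distribution N"
    by (simp add: real_distribution_def real_distribution_axioms_def)
  have cdf_N: "cdf N = (\<lambda>t. \<theta> * cdf \<mu> t + (1 - \<theta>) * cdf \<nu> t)"
  proof
    fix t
    have "cdf N t = (\<integral>b. measure (k b) {..t} \<partial>bernoulli_pmf \<theta>)"
      unfolding cdf_def N_def by (rule measure_pmf.measure_bind[OF kK]) simp
    thus "cdf N t = \<theta> * cdf \<mu> t + (1 - \<theta>) * cdf \<nu> t"
      using \<theta> by (simp add: k_def cdf_def)
  qed
  interpret N: real_distribution N by (rule N)
  \<comment> \<open>A distribution function determines its law, so the Lebesgue-Stieltjes measure is
    the mixture itself.\<close>
  have "interval_measure (cdf N) = N"
  proof (rule cdf_unique)
    show "real_distribution (interval_measure (cdf N))"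
      by (intro real_distribution_interval_measure N.cdf_nondecreasing N.cdf_is_right_cont
           N.cdf_lim_at_bot N.cdf_lim_at_top_prob)
    show "cdf (interval_measure (cdf N)) = cdf N"
      by (intro cdf_interval_measure N.cdf_nondecreasing N.cdf_is_right_cont N.cdf_lim_at_bot)
  qed (rule N)
  moreover have "(\<integral>t. f t \<partial>N) = (\<integral>b. (\<integral>t. f t \<partial>k b) \<partial>bernoulli_pmf \<theta>)"
    unfolding N_def
    by (rule integral_bind[OF f(1) f(2) kK, where B' = 1])
       (simp_all add: measure_pmf.finite_measure_axioms prob_space.emeasure_space_1[OF pk])
  ultimately show ?thesis using \<theta> by (simp add: cdf_N k_def)
qed

text \<open>The right side is symmetric in \<open>\<mu>\<close> and \<open>\<nu>\<close>, so both
  laws give the squared difference the same integral.\<close>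

lemma integral_cdf_diff_sq:
  assumes "real_distribution \<mu>" "real_distribution \<nu>"
    and atom: "\<And>x. measure \<mu> {x} = 0" "\<And>x. measure \<nu> {x} = 0"
  shows "(\<integral>x. (cdf \<mu> x - cdf \<nu> x)\<^sup>2 \<partial>\<mu>) = (\<integral>x. (cdf \<nu> x)\<^sup>2 \<partial>\<mu>) + (\<integral>x. (cdf \<mu> x)\<^sup>2 \<partial>\<nu>) - 2 / 3"
proof -
  interpret \<mu>: real_distribution \<mu> by fact
  interpret \<nu>: real_distribution \<nu> by fact
  have b: "\<bar>cdf \<mu> x\<bar> \<le> 1" "\<bar>cdf \<nu> x\<bar> \<le> 1" for x
    by (auto simp: \<mu>.cdf_nonneg \<nu>.cdf_nonneg \<mu>.cdf_bounded_prob \<nu>.cdf_bounded_prob)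
  have i: "integrable \<mu> (\<lambda>x. (cdf \<mu> x)\<^sup>2)" "integrable \<mu> (\<lambda>x. (cdf \<nu> x)\<^sup>2)" "integrable \<mu> (\<lambda>x. cdf \<mu> x * cdf \<nu> x)"
    using b by (auto intro!: \<mu>.integrable_bounded[where B = 1] mult_le_one simp: power2_eq_square abs_mult
      \<mu>.cdf_nonneg \<nu>.cdf_nonneg \<mu>.cdf_bounded_prob \<nu>.cdf_bounded_prob)
  have "(\<integral>x. (cdf \<mu> x - cdf \<nu> x)\<^sup>2 \<partial>\<mu>)
      = (\<integral>x. (cdf \<mu> x)\<^sup>2 + (cdf \<nu> x)\<^sup>2 - 2 * (cdf \<mu> x * cdf \<nu> x) \<partial>\<mu>)"
    by (rule Bochner_Integration.integral_cong) (auto simp: power2_eq_square algebra_simps)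
  also have "\<dots> = (\<integral>x. (cdf \<mu> x)\<^sup>2 \<partial>\<mu>) + (\<integral>x. (cdf \<nu> x)\<^sup>2 \<partial>\<mu>) - 2 * (\<integral>x. cdf \<mu> x * cdf \<nu> x \<partial>\<mu>)"
    using i by simp
  \<comment> \<open>The cyclic identity with three copies of \<open>\<mu>\<close> gives the value
    1/3; with two copies of \<open>\<mu>\<close> and one of \<open>\<nu>\<close> it gives the mixed
    term.\<close>
  finally show ?thesis
    using integral_cdf_mult_cyclic[OF assms(1) assms(1) assms(1) atom(1) atom(1)]
      integral_cdf_mult_cyclic[OF assms(1) assms(1) assms(2) atom(1) atom(2)]
    by (simp add: power2_eq_square mult.commute)
qed

subsection \<open>Integration over the sphere\<close>

lemma borel_measurable_sgn_euclidean [measurable]: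
  "(sgn :: 'a::euclidean_space \<Rightarrow> 'a) \<in> borel_measurable borel"
  unfolding sgn_div_norm by measurable

lemma AE_ball_measure_sgn_in_sphere: "AE x in ball_measure. sgn (x :: 'a::euclidean_space) \<in> sphere 0 1"
  using AE_ball_measureI[OF AE_lborel_singleton[of 0]] by eventually_elim (simp add: norm_sgn)

text \<open>\<open>uniform_sphere\<close> is the image of \<open>ball_measure\<close> under
  \<open>sgn\<close>, restricted to a set of full measure. This carries the continuity hypothesis
  over to the ball.\<close>

lemma AE_uniform_sphereD:
  assumes "AE \<beta> in uniform_sphere. P \<beta>"
  shows "AE x in ball_measure. P (sgn (x :: 'a::euclidean_space))"
proof -
  have "AE \<beta> in distr ball_measure borel sgn. \<beta> \<in> sphere 0 1 \<longrightarrow> P \<beta>"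
    using assms unfolding uniform_sphere_def ball_measure_def[symmetric]
    by (subst (asm) AE_restrict_space_iff) auto
  hence "AE x in ball_measure. sgn x \<in> sphere 0 1 \<longrightarrow> P (sgn x)"
    by (rule AE_distrD[rotated]) measurable
  with AE_ball_measure_sgn_in_sphere show ?thesis by eventually_elim auto
qed

text \<open>The restriction becomes an indicator that is almost surely 1, since \<open>sgn x\<close>
  leaves the sphere only at \<open>x = 0\<close>.\<close>

lemma integral_uniform_sphere:
  fixes f :: "'a::euclidean_space \<Rightarrow> real"
  assumes [measurable]: "f \<in> borel_measurable borel"
  shows "(\<integral>\<beta>. f \<beta> \<partial>uniform_sphere) = (\<integral>x. f (sgn x) \<partial>ball_measure)"
proof -
  have [measurable]: "sphere (0::'a) 1 \<in> sets borel" by simp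
  have "(\<integral>\<beta>. f \<beta> \<partial>uniform_sphere) = (\<integral>\<beta>. indicator (sphere 0 1) \<beta> *\<^sub>R f \<beta> \<partial>distr ball_measure borel sgn)"
    unfolding uniform_sphere_def ball_measure_def[symmetric] by (rule integral_restrict_space) simp
  also have "\<dots> = (\<integral>x. indicator (sphere 0 1) (sgn x :: 'a) *\<^sub>R f (sgn x) \<partial>ball_measure)"
    by (rule integral_distr) measurable
  also have "\<dots> = (\<integral>x. f (sgn x) \<partial>ball_measure)"
  proof (rule integral_cong_AE)
    show "AE x in ball_measure. indicator (sphere 0 1) (sgn x :: 'a) *\<^sub>R f (sgn x) = f (sgn x)"
      using AE_ball_measure_sgn_in_sphere by eventually_elim simp
  qed measurable
  finally show ?thesis .
qed

subsection \<open>The Cramer-von Mises distance\<close>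

locale borel_prob = prob_space P for P :: "'a::euclidean_space measure" +
  assumes sets_eq [measurable_cong, simp]: "sets P = sets borel"
begin

lemma space_eq [simp]: "space P = UNIV"
  using sets_eq_imp_space_eq[OF sets_eq] by simp

lemma real_distribution_proj: "real_distribution (distr P borel (\<lambda>x. \<beta> \<bullet> x))"
  by (rule real_distribution_distr) measurable

lemma proj_cdf_eq: "proj_cdf P \<beta> t = measure P {x. \<beta> \<bullet> x \<le> t}"
  unfolding proj_cdf_def cdf_def by (subst measure_distr) (auto intro!: arg_cong[where f = "measure P"])

lemma proj_cdf_bounds: "0 \<le> proj_cdf P \<beta> t" "proj_cdf P \<beta> t \<le> 1"
  by (auto simp: proj_cdf_eq)

text \<open>An integral of an indicator that depends measurably on direction and threshold is
  jointly measurable in both; integration over directions relies on this.\<close>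

lemma borel_measurable_proj_cdf [measurable (raw)]:
  assumes [measurable]: "f \<in> borel_measurable M" "g \<in> borel_measurable M"
  shows "(\<lambda>x. proj_cdf P (f x) (g x)) \<in> borel_measurable M"
proof -
  have "proj_cdf P \<beta> t = (\<integral>x. (if \<beta> \<bullet> x \<le> t then 1 else 0) \<partial>P)" for \<beta> t
  proof -
    have "(\<integral>x. (if \<beta> \<bullet> x \<le> t then 1 else 0 :: real) \<partial>P) = (\<integral>x. indicator {x. \<beta> \<bullet> x \<le> t} x \<partial>P)"
      by (rule Bochner_Integration.integral_cong) auto
    thus ?thesis by (simp add: proj_cdf_eq)
  qed
  thus ?thesis by simp
qed

lemma no_atoms_proj:
  assumes "continuous_on UNIV (proj_cdf P \<beta>)"
  shows "measure (distr P borel (\<lambda>x. \<beta> \<bullet> x)) {t} = 0"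
proof -
  interpret D: real_distribution "distr P borel (\<lambda>x. \<beta> \<bullet> x)" by (rule real_distribution_proj)
  show ?thesis
    using assms by (simp add: D.isCont_cdf[symmetric] proj_cdf_def continuous_on_eq_continuous_at)
qed

text \<open>Equal points have equal projections, and the projected law has no mass at
  \<open>\<beta> \<bullet> y\<close>. This makes the vectors whose angle is taken nonzero almost
  surely.\<close>

lemma AE_neq:
  assumes "continuous_on UNIV (proj_cdf P \<beta>)"
  shows "AE x in P. x \<noteq> y"
proof -
  have "measure P {x. \<beta> \<bullet> x = \<beta> \<bullet> y} = measure (distr P borel (\<lambda>x. \<beta> \<bullet> x)) {\<beta> \<bullet> y}"
    by (subst measure_distr) (auto intro!: arg_cong[where f = "measure P"])
  hence "{x. \<beta> \<bullet> x = \<beta> \<bullet> y} \<in> null_sets P"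
    using no_atoms_proj[OF assms] by (intro null_setsI) (auto simp: emeasure_eq_measure)
  thus ?thesis by (rule AE_I') auto
qed

end

text \<open>
  \<open>R'\<close> only serves to give both sides of the independence assumption the same type, as
  \<open>indep_var\<close> demands.
\<close>
lemma expectation_Ang:
  fixes P Q :: "'a::euclidean_space measure" and S T R R' :: "'w \<Rightarrow> 'a"
  assumes "borel_prob P" "borel_prob Q" "prob_space M"
    and law: "distr M borel S = P" "distr M borel T = P" "distr M borel R = Q"
    and ST: "prob_space.indep_var M borel S borel T"
    and STR: "prob_space.indep_var M (borel \<Otimes>\<^sub>M borel) (\<lambda>\<omega>. (S \<omega>, T \<omega>)) (borel \<Otimes>\<^sub>M borel) (\<lambda>\<omega>. (R \<omega>, R' \<omega>))"
    and cont: "AE \<beta> in uniform_sphere. continuous_on UNIV (proj_cdf P \<beta>)"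
  shows "(\<integral>x. (\<integral>y. (proj_cdf P (sgn x) (sgn x \<bullet> y))\<^sup>2 \<partial>Q) \<partial>ball_measure)
    = 1 / 2 - 1 / (2 * pi) * prob_space.expectation M (\<lambda>\<omega>. Ang (S \<omega> - R \<omega>) (T \<omega> - R \<omega>))"
proof -
  interpret P: borel_prob P by fact
  interpret Q: borel_prob Q by fact
  interpret M: prob_space M by fact
  interpret PP: pair_prob_space P P ..
  interpret PQ: pair_prob_space P Q ..
  interpret MB: pair_prob_space M "ball_measure :: 'a measure" ..
  have [measurable]: "S \<in> borel_measurable M" "T \<in> borel_measurable M"
    using M.indep_var_rv1[OF ST] M.indep_var_rv2[OF ST] .
  have RR [measurable]: "(\<lambda>\<omega>. (R \<omega>, R' \<omega>)) \<in> measurable M (borel \<Otimes>\<^sub>M borel)"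
    by (rule M.indep_var_rv2[OF STR])
  have [measurable]: "R \<in> borel_measurable M"
    using measurable_compose[OF RR measurable_fst] by simp
  \<comment> \<open>The pair is kept whole because independence is assumed between pairs; the
    integrands read its first component.\<close>
  define L where "L = distr M (borel \<Otimes>\<^sub>M borel) (\<lambda>\<omega>. (R \<omega>, R' \<omega>))"
  have [measurable_cong, simp]: "sets L = sets (borel \<Otimes>\<^sub>M borel)" by (simp add: L_def)
  interpret L: prob_space L unfolding L_def by (rule M.prob_space_distr[OF RR])
  interpret PPL: pair_prob_space "P \<Otimes>\<^sub>M P" L ..
  have lawST: "distr M (borel \<Otimes>\<^sub>M borel) (\<lambda>\<omega>. (S \<omega>, T \<omega>)) = P \<Otimes>\<^sub>M P"
    using ST by (simp add: M.indep_var_distribution_eq law)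
  have joint: "distr M ((borel \<Otimes>\<^sub>M borel) \<Otimes>\<^sub>M (borel \<Otimes>\<^sub>M borel))
      (\<lambda>\<omega>. ((S \<omega>, T \<omega>), (R \<omega>, R' \<omega>))) = (P \<Otimes>\<^sub>M P) \<Otimes>\<^sub>M L"
    using STR by (simp add: M.indep_var_distribution_eq lawST L_def)
  \<comment> \<open>Integrated over independent \<open>s\<close> and \<open>t\<close>, this
    indicator gives the squared distribution function at \<open>\<beta> \<bullet> r\<close>;
    integrated over \<open>\<beta>\<close>, the measure of a lune.\<close>
  define g where "g \<beta> s t r = indicator {..\<beta> \<bullet> r} (\<beta> \<bullet> s) * (indicator {..\<beta> \<bullet> r} (\<beta> \<bullet> t) :: real)"
    for \<beta> s t r :: 'a
  have g_bound: "\<bar>g \<beta> s t r\<bar> \<le> 1" for \<beta> s t r by (simp add: g_def indicator_def)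
  have g_measurable [measurable (raw)]: "(\<lambda>x. g (a x) (b x) (c x) (d x)) \<in> borel_measurable N"
    if [measurable]: "a \<in> borel_measurable N" "b \<in> borel_measurable N" "c \<in> borel_measurable N" "d \<in> borel_measurable N"
    for a b c d and N :: "'z measure"
    unfolding g_def indicator_def atMost_iff by measurable
  have inner: "(\<integral>y. (proj_cdf P \<beta> (\<beta> \<bullet> y))\<^sup>2 \<partial>Q) = (\<integral>\<omega>. g \<beta> (S \<omega>) (T \<omega>) (R \<omega>) \<partial>M)" for \<beta>
  proof -
    have sq: "(\<integral>p. g \<beta> (fst p) (snd p) y \<partial>(P \<Otimes>\<^sub>M P)) = (proj_cdf P \<beta> (\<beta> \<bullet> y))\<^sup>2" for y
    proof -
      have int: "integrable (P \<Otimes>\<^sub>M P) (\<lambda>p. g \<beta> (fst p) (snd p) y)"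
        using g_bound by (intro PP.P.integrable_const_bound[where B = 1]) auto
      have half: "(\<integral>s. indicator {..\<beta> \<bullet> y} (\<beta> \<bullet> s) \<partial>P) = proj_cdf P \<beta> (\<beta> \<bullet> y)"
      proof -
        have "(\<integral>s. indicat_real {..\<beta> \<bullet> y} (\<beta> \<bullet> s) \<partial>P) = (\<integral>s. indicator {s. \<beta> \<bullet> s \<le> \<beta> \<bullet> y} s \<partial>P)"
          by (rule Bochner_Integration.integral_cong) (auto simp: indicator_def)
        thus ?thesis by (simp add: P.proj_cdf_eq)
      qed
      have "(\<integral>p. g \<beta> (fst p) (snd p) y \<partial>(P \<Otimes>\<^sub>M P)) = (\<integral>s. (\<integral>t. g \<beta> s t y \<partial>P) \<partial>P)"
        using PP.integral_fst'[OF int] by simp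
      thus ?thesis by (simp add: g_def half power2_eq_square)
    qed
    have int: "integrable ((P \<Otimes>\<^sub>M P) \<Otimes>\<^sub>M L) (\<lambda>(p, y). g \<beta> (fst p) (snd p) (fst y))"
      unfolding case_prod_beta using g_bound by (intro PPL.P.integrable_const_bound[where B = 1]) auto
    have "(\<integral>\<omega>. g \<beta> (S \<omega>) (T \<omega>) (R \<omega>) \<partial>M)
        = (\<integral>(p, y). g \<beta> (fst p) (snd p) (fst y) \<partial>((P \<Otimes>\<^sub>M P) \<Otimes>\<^sub>M L))"
      unfolding joint[symmetric] case_prod_beta by (subst integral_distr) simp_all
    also have "\<dots> = (\<integral>y. (\<integral>p. g \<beta> (fst p) (snd p) (fst y) \<partial>(P \<Otimes>\<^sub>M P)) \<partial>L)"
      using PPL.integral_snd[OF int] by simp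
    also have "\<dots> = (\<integral>y. (proj_cdf P \<beta> (\<beta> \<bullet> fst y))\<^sup>2 \<partial>L)" by (simp add: sq)
    also have "\<dots> = (\<integral>\<omega>. (proj_cdf P \<beta> (\<beta> \<bullet> R \<omega>))\<^sup>2 \<partial>M)"
      unfolding L_def by (subst integral_distr) simp_all
    also have "\<dots> = (\<integral>y. (proj_cdf P \<beta> (\<beta> \<bullet> y))\<^sup>2 \<partial>Q)"
      unfolding law(3)[symmetric] by (subst integral_distr) simp_all
    finally show ?thesis ..
  qed
  \<comment> \<open>Both inequalities in \<open>g\<close> survive positive scaling of
    \<open>\<beta>\<close>, and \<open>sgn 0 = 0\<close> settles the origin. This replaces
    directions by points of the ball.\<close>
  have g_sgn: "g (sgn \<beta>) s t r = g \<beta> s t r" for \<beta> s t r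
    by (cases "\<beta> = 0") (auto simp: g_def sgn_div_norm indicator_def)
  \<comment> \<open>A property that holds almost everywhere under a probability measure holds
    somewhere; a single direction of continuity excludes atoms of \<open>P\<close>.\<close>
  have "\<exists>\<beta>. continuous_on UNIV (proj_cdf P \<beta>)"
  proof -
    have "\<exists>x. continuous_on UNIV (proj_cdf P (sgn x))"
      using AE_uniform_sphereD[OF cont] ball_measure.AE_contr by blast
    thus ?thesis by blast
  qed
  then obtain \<beta>\<^sub>0 where \<beta>\<^sub>0: "continuous_on UNIV (proj_cdf P \<beta>\<^sub>0)" by blast
  have neq: "AE \<omega> in M. Z \<omega> \<noteq> R \<omega>" if "M.indep_var borel Z borel R" "distr M borel Z = P" for Z
  proof -
    have [measurable]: "Z \<in> borel_measurable M" by (rule M.indep_var_rv1[OF that(1)])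
    have "AE y in Q. AE x in P. x \<noteq> y" using P.AE_neq[OF \<beta>\<^sub>0] by simp
    moreover have m: "{p \<in> space (P \<Otimes>\<^sub>M Q). fst p \<noteq> snd p} \<in> sets (P \<Otimes>\<^sub>M Q)"
      by measurable
    ultimately have "AE x in P. AE y in Q. x \<noteq> y"
      by (subst PQ.AE_commute)
    hence "AE p in P \<Otimes>\<^sub>M Q. fst p \<noteq> snd p"
      by (intro PQ.AE_pair_measure m) simp
    moreover have "distr M (borel \<Otimes>\<^sub>M borel) (\<lambda>\<omega>. (Z \<omega>, R \<omega>)) = P \<Otimes>\<^sub>M Q"
      using that by (simp add: M.indep_var_distribution_eq law)
    ultimately have "AE p in distr M (borel \<Otimes>\<^sub>M borel) (\<lambda>\<omega>. (Z \<omega>, R \<omega>)). fst p \<noteq> snd p"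
      by (simp only:)
    from AE_distrD[OF _ this] show ?thesis by simp
  qed
  have "M.indep_var borel (fst \<circ> (\<lambda>\<omega>. (S \<omega>, T \<omega>))) borel (fst \<circ> (\<lambda>\<omega>. (R \<omega>, R' \<omega>)))"
    "M.indep_var borel (snd \<circ> (\<lambda>\<omega>. (S \<omega>, T \<omega>))) borel (fst \<circ> (\<lambda>\<omega>. (R \<omega>, R' \<omega>)))"
    by (rule M.indep_var_compose[OF STR]; simp)+
  hence "M.indep_var borel S borel R" "M.indep_var borel T borel R" by (simp_all add: comp_def)
  from neq[OF this(1) law(1)] neq[OF this(2) law(2)]
  have lune: "AE \<omega> in M. (\<integral>x. g x (S \<omega>) (T \<omega>) (R \<omega>) \<partial>ball_measure) = 1 / 2 - Ang (S \<omega> - R \<omega>) (T \<omega> - R \<omega>) / (2 * pi)"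
  proof eventually_elim
    fix \<omega> assume *: "S \<omega> \<noteq> R \<omega>" "T \<omega> \<noteq> R \<omega>"
    have "(\<integral>x. g x (S \<omega>) (T \<omega>) (R \<omega>) \<partial>ball_measure)
        = (\<integral>x. indicator {x. (S \<omega> - R \<omega>) \<bullet> x \<le> 0 \<and> (T \<omega> - R \<omega>) \<bullet> x \<le> 0} x \<partial>ball_measure)"
      by (rule Bochner_Integration.integral_cong)
         (auto simp: g_def indicator_def inner_diff_left inner_diff_right inner_commute)
    also have "\<dots> = measure ball_measure {x. (S \<omega> - R \<omega>) \<bullet> x \<le> 0 \<and> (T \<omega> - R \<omega>) \<bullet> x \<le> 0}"
      by simp
    finally show "(\<integral>x. g x (S \<omega>) (T \<omega>) (R \<omega>) \<partial>ball_measure) = 1 / 2 - Ang (S \<omega> - R \<omega>) (T \<omega> - R \<omega>) / (2 * pi)"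
      using * by (simp add: measure_ball_lune)
  qed
  have "(\<integral>x. (\<integral>y. (proj_cdf P (sgn x) (sgn x \<bullet> y))\<^sup>2 \<partial>Q) \<partial>ball_measure)
      = (\<integral>x. (\<integral>\<omega>. g x (S \<omega>) (T \<omega>) (R \<omega>) \<partial>M) \<partial>ball_measure)"
    by (simp add: inner g_sgn)
  also have "\<dots> = (\<integral>\<omega>. (\<integral>x. g x (S \<omega>) (T \<omega>) (R \<omega>) \<partial>ball_measure) \<partial>M)"
    by (rule MB.Fubini_integral_bounded[OF _ g_bound]) (simp add: case_prod_beta)
  also have "\<dots> = (\<integral>\<omega>. 1 / 2 - Ang (S \<omega> - R \<omega>) (T \<omega> - R \<omega>) / (2 * pi) \<partial>M)"
    using lune by (intro integral_cong_AE) simp_all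
  also have "\<dots> = 1 / 2 - (\<integral>\<omega>. Ang (S \<omega> - R \<omega>) (T \<omega> - R \<omega>) \<partial>M) / (2 * pi)"
  proof -
    have "integrable M (\<lambda>\<omega>. Ang (S \<omega> - R \<omega>) (T \<omega> - R \<omega>))"
      by (rule M.integrable_const_bound[where B = pi]) (simp_all add: Ang_bounds abs_of_nonneg)
    thus ?thesis by (simp add: M.prob_space)
  qed
  finally show ?thesis by simp
qed

section \<open>The distance as an average over directions\<close>

lemma cvm_distance_sq_eq:
  fixes P Q :: "'a::euclidean_space measure"
  assumes "borel_prob P" "borel_prob Q" and \<theta>: "0 \<le> \<theta>" "\<theta> \<le> 1"
    and cont: "AE \<beta> in uniform_sphere. continuous_on UNIV (proj_cdf P \<beta>) \<and> continuous_on UNIV (proj_cdf Q \<beta>)"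
  shows "cvm_distance_sq \<theta> P Q =
      (\<integral>x. (\<integral>y. (proj_cdf P (sgn x) (sgn x \<bullet> y))\<^sup>2 \<partial>Q) \<partial>ball_measure)
    + (\<integral>x. (\<integral>y. (proj_cdf Q (sgn x) (sgn x \<bullet> y))\<^sup>2 \<partial>P) \<partial>ball_measure) - 2 / 3"
proof -
  interpret P: borel_prob P by fact
  interpret Q: borel_prob Q by fact
  let ?D = "\<lambda>\<beta> t. (proj_cdf P \<beta> t - proj_cdf Q \<beta> t)\<^sup>2"
  let ?A = "\<lambda>\<beta>. (\<integral>y. (proj_cdf P \<beta> (\<beta> \<bullet> y))\<^sup>2 \<partial>Q)" and ?B = "\<lambda>\<beta>. (\<integral>y. (proj_cdf Q \<beta> (\<beta> \<bullet> y))\<^sup>2 \<partial>P)"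
  \<comment> \<open>The inner integral of the distance as expectations under \<open>P\<close> and
    \<open>Q\<close>. This form is valid in every direction and Borel there; the form without
    \<open>\<theta>\<close> is derived for directions of continuity.\<close>
  define G where "G \<beta> = \<theta> * (\<integral>x. ?D \<beta> (\<beta> \<bullet> x) \<partial>P) + (1 - \<theta>) * (\<integral>x. ?D \<beta> (\<beta> \<bullet> x) \<partial>Q)" for \<beta>
  have [measurable]: "G \<in> borel_measurable borel" unfolding G_def by measurable
  have [measurable]: "?A \<in> borel_measurable borel" "?B \<in> borel_measurable borel" by measurable
  have D_bound: "\<bar>?D \<beta> t\<bar> \<le> 1" for \<beta> t
    using P.proj_cdf_bounds[of \<beta> t] Q.proj_cdf_bounds[of \<beta> t] by (simp add: abs_square_le_1)
  have G: "(\<integral>t. ?D \<beta> t \<partial>interval_measure (\<lambda>t. \<theta> * proj_cdf P \<beta> t + (1 - \<theta>) * proj_cdf Q \<beta> t)) = G \<beta>" for \<beta>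
  proof -
    have "(\<integral>t. ?D \<beta> t \<partial>interval_measure (\<lambda>t. \<theta> * proj_cdf P \<beta> t + (1 - \<theta>) * proj_cdf Q \<beta> t))
      = \<theta> * (\<integral>t. ?D \<beta> t \<partial>distr P borel (\<lambda>x. \<beta> \<bullet> x)) + (1 - \<theta>) * (\<integral>t. ?D \<beta> t \<partial>distr Q borel (\<lambda>x. \<beta> \<bullet> x))"
      unfolding proj_cdf_def[of P \<beta>] proj_cdf_def[of Q \<beta>]
      by (rule integral_interval_measure_mixture[OF P.real_distribution_proj Q.real_distribution_proj \<theta>])
         (use D_bound in \<open>auto simp: proj_cdf_def[symmetric]\<close>)
    thus ?thesis by (simp add: G_def integral_distr)
  qed
  have G_eq: "G \<beta> = ?A \<beta> + ?B \<beta> - 2 / 3"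
    if "continuous_on UNIV (proj_cdf P \<beta>)" "continuous_on UNIV (proj_cdf Q \<beta>)" for \<beta>
  proof -
    let ?\<mu> = "distr P borel (\<lambda>x. \<beta> \<bullet> x)" and ?\<nu> = "distr Q borel (\<lambda>x. \<beta> \<bullet> x)"
    note a = P.no_atoms_proj[OF that(1)] Q.no_atoms_proj[OF that(2)]
    have "(\<integral>x. ?D \<beta> (\<beta> \<bullet> x) \<partial>P) = (\<integral>t. ?D \<beta> t \<partial>?\<mu>)" by (simp add: integral_distr)
    also have "\<dots> = (\<integral>t. (proj_cdf Q \<beta> t)\<^sup>2 \<partial>?\<mu>) + (\<integral>t. (proj_cdf P \<beta> t)\<^sup>2 \<partial>?\<nu>) - 2 / 3"
      unfolding proj_cdf_def
      by (rule integral_cdf_diff_sq[OF P.real_distribution_proj Q.real_distribution_proj a])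
    also have "\<dots> = ?A \<beta> + ?B \<beta> - 2 / 3" by (simp add: integral_distr)
    finally have 1: "(\<integral>x. ?D \<beta> (\<beta> \<bullet> x) \<partial>P) = ?A \<beta> + ?B \<beta> - 2 / 3" .
    have "(\<integral>x. ?D \<beta> (\<beta> \<bullet> x) \<partial>Q) = (\<integral>t. (proj_cdf Q \<beta> t - proj_cdf P \<beta> t)\<^sup>2 \<partial>?\<nu>)"
      by (simp add: integral_distr power2_commute)
    also have "\<dots> = (\<integral>t. (proj_cdf P \<beta> t)\<^sup>2 \<partial>?\<nu>) + (\<integral>t. (proj_cdf Q \<beta> t)\<^sup>2 \<partial>?\<mu>) - 2 / 3"
      unfolding proj_cdf_def
      by (rule integral_cdf_diff_sq[OF Q.real_distribution_proj P.real_distribution_proj a(2) a(1)])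
    also have "\<dots> = ?A \<beta> + ?B \<beta> - 2 / 3" by (simp add: integral_distr)
    finally have 2: "(\<integral>x. ?D \<beta> (\<beta> \<bullet> x) \<partial>Q) = ?A \<beta> + ?B \<beta> - 2 / 3" .
    have "\<theta> * c + (1 - \<theta>) * c = c" for c by (simp add: algebra_simps)
    thus ?thesis unfolding G_def 1 2 .
  qed
  have bounded: "integrable ball_measure (\<lambda>x. ?A (sgn x))" "integrable ball_measure (\<lambda>x. ?B (sgn x))"
  proof -
    have "0 \<le> ?A \<beta>" "?A \<beta> \<le> 1" "0 \<le> ?B \<beta>" "?B \<beta> \<le> 1" for \<beta>
      by (auto intro!: integral_nonneg P.integral_le_const Q.integral_le_const
          P.integrable_const_bound[where B = 1] Q.integrable_const_bound[where B = 1]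
          simp: power_le_one P.proj_cdf_bounds Q.proj_cdf_bounds)
    thus "integrable ball_measure (\<lambda>x. ?A (sgn x))" "integrable ball_measure (\<lambda>x. ?B (sgn x))"
      by (auto intro!: ball_measure.integrable_const_bound[where B = 1])
  qed
  have "cvm_distance_sq \<theta> P Q = (\<integral>x. G (sgn x) \<partial>ball_measure)"
    unfolding cvm_distance_sq_def G by (rule integral_uniform_sphere) measurable
  also have "\<dots> = (\<integral>x. ?A (sgn x) + ?B (sgn x) - 2 / 3 \<partial>ball_measure)"
  proof (rule integral_cong_AE)
    show "AE x in ball_measure. G (sgn x) = ?A (sgn x) + ?B (sgn x) - 2 / 3"
      using AE_uniform_sphereD[OF cont] by eventually_elim (simp add: G_eq)
  qed measurable
  also have "\<dots> = (\<integral>x. ?A (sgn x) \<partial>ball_measure) + (\<integral>x. ?B (sgn x) \<partial>ball_measure) - 2 / 3"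
    using bounded ball_measure.prob_space by simp
  finally show ?thesis .
qed

lemma (in prob_space) indep_var_swap:
  assumes "indep_var S X T Y"
  shows "indep_var T Y S X"
proof -
  have "indep_set A B \<Longrightarrow> indep_set B A" for A B
    unfolding indep_sets2_eq by (metis Int_commute mult.commute)
  with assms show ?thesis unfolding indep_var_eq by blast
qed

theorem theorem2p1:
  fixes P\<^sub>X P\<^sub>Y :: "(real ^ 'd) measure"
    and M :: "'w measure"
    and X\<^sub>1 X\<^sub>2 Y\<^sub>1 Y\<^sub>2 :: "'w \<Rightarrow> real ^ 'd"
    and \<theta> :: real
  assumes "0 < \<theta>" and "\<theta> < 1"
    and "prob_space P\<^sub>X" and "sets P\<^sub>X = sets borel"
    and "prob_space P\<^sub>Y" and "sets P\<^sub>Y = sets borel"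
    and "AE \<beta> in uniform_sphere.
           continuous_on UNIV (proj_cdf P\<^sub>X \<beta>) \<and> continuous_on UNIV (proj_cdf P\<^sub>Y \<beta>)"
    and "prob_space M"
    and "distr M borel X\<^sub>1 = P\<^sub>X" and "distr M borel X\<^sub>2 = P\<^sub>X"
    and "distr M borel Y\<^sub>1 = P\<^sub>Y" and "distr M borel Y\<^sub>2 = P\<^sub>Y"
    and "prob_space.indep_var M borel X\<^sub>1 borel X\<^sub>2"
    and "prob_space.indep_var M borel Y\<^sub>1 borel Y\<^sub>2"
    and "prob_space.indep_var M
           (borel \<Otimes>\<^sub>M borel) (\<lambda>\<omega>. (X\<^sub>1 \<omega>, X\<^sub>2 \<omega>)) (borel \<Otimes>\<^sub>M borel) (\<lambda>\<omega>. (Y\<^sub>1 \<omega>, Y\<^sub>2 \<omega>))"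
  shows "cvm_distance_sq \<theta> P\<^sub>X P\<^sub>Y =
    1 / 3
    - 1 / (2 * pi) * prob_space.expectation M (\<lambda>\<omega>. Ang (X\<^sub>1 \<omega> - Y\<^sub>1 \<omega>) (X\<^sub>2 \<omega> - Y\<^sub>1 \<omega>))
    - 1 / (2 * pi) * prob_space.expectation M (\<lambda>\<omega>. Ang (Y\<^sub>1 \<omega> - X\<^sub>1 \<omega>) (Y\<^sub>2 \<omega> - X\<^sub>1 \<omega>))"
proof -
  interpret M: prob_space M by fact
  have P: "borel_prob P\<^sub>X" and Q: "borel_prob P\<^sub>Y"
    using assms(3-6) by (simp_all add: borel_prob_def borel_prob_axioms_def)
  have cont: "AE \<beta> in uniform_sphere. continuous_on UNIV (proj_cdf P\<^sub>X \<beta>)"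
    "AE \<beta> in uniform_sphere. continuous_on UNIV (proj_cdf P\<^sub>Y \<beta>)"
    using assms(7) by auto
  \<comment> \<open>The second use of \<open>expectation_Ang\<close> exchanges the samples, so its
    angle is seen from \<open>X\<^sub>1\<close>. The constants give 1/2 + 1/2 - 2/3 = 1/3.\<close>
  show ?thesis
    using cvm_distance_sq_eq[OF P Q _ _ assms(7), of \<theta>] assms(1,2)
      expectation_Ang[OF P Q assms(8,9,10,11,13,15) cont(1)]
      expectation_Ang[OF Q P assms(8,11,12,9,14) M.indep_var_swap[OF assms(15)] cont(2)]
    by simp
qed

end
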